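(* Let $\ell$ and $m$ be integers with $2\le\ell\le m$, let $G$ be a torsion-free group written additively, let $\mathbf{a}=(a_1,\dots,a_m)$ be a sequence of elements of $G$, and let $A$ be the set of distinct terms of $\mathbf{a}$. Assume that $\mu_{\mathbf{a}}(a)=\ell$ for some $a\in A$, that $|\{a\in A:\mu_{\mathbf{a}}(a)\ge2\}|\ge2$, and that \[ |\Sigma^{\ell}(\mathbf{a})|=\sum_{a\in A}\mu_{\mathbf{a}}(a)-\ell+1 . \] Then $A$ is an arithmetic progression.
   Context: $\Sigma^{\ell}(\mathbf{a})$ is the set of all elements $a_{i_1}+\cdots+a_{i_\ell}$ with $i_1,\dots,i_\ell\in[1,m]$ pairwise distinct, taken in any order. $\rho_a(\mathbf{a})=|\{i:a_i=a\}|$, $\mu_{\mathbf{a}}(a)=\min(\ell,\rho_a(\mathbf{a}))$. An arithmetic progression is a set $\{c+jd: j\in[0,k-1]\}$ with $d\neq0$. *)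

theory Defs
  imports Main
begin

definition nsmul :: "nat \<Rightarrow> 'a::monoid_add \<Rightarrow> 'a" where
  "nsmul n x = sum_list (replicate n x)"

definition torsion_free :: "'a::group_add itself \<Rightarrow> bool" where
  "torsion_free _ \<longleftrightarrow> (\<forall>(x::'a) n. 0 < n \<and> nsmul n x = 0 \<longrightarrow> x = 0)"

definition restricted_sumset :: "nat \<Rightarrow> nat \<Rightarrow> (nat \<Rightarrow> 'a::monoid_add) \<Rightarrow> 'a set" where
  "restricted_sumset l m a =
     {sum_list (map a is) | is. length is = l \<and> distinct is \<and> set is \<subseteq> {1..m}}"

definition rho :: "nat \<Rightarrow> (nat \<Rightarrow> 'a) \<Rightarrow> 'a \<Rightarrow> nat" where
  "rho m a x = card {i \<in> {1..m}. a i = x}"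

definition mu :: "nat \<Rightarrow> nat \<Rightarrow> (nat \<Rightarrow> 'a) \<Rightarrow> 'a \<Rightarrow> nat" where
  "mu l m a x = min l (rho m a x)"

definition arith_prog :: "'a::monoid_add set \<Rightarrow> bool" where
  "arith_prog S \<longleftrightarrow> (\<exists>c d k. d \<noteq> 0 \<and> S = {c + nsmul j d | j. j < k})"

end

theory Submission
  imports Defs "HOL-Library.Set_Algebras"
begin

text \<open>
  The proof uses Hamidoune's isoperimetric method. For a finite set \<open>S\<close>, a \<open>k\<close>-atom is a set \<open>M\<close> of
  least cardinality among the sets of at least \<open>k\<close> elements minimising \<open>|M + S| - |M|\<close>. By
  submodularity, distinct left translates of \<open>M\<close> meet in fewer than \<open>k\<close> points. For \<open>k = 1\<close> this
  makes \<open>M\<close> a singleton, which is Kemperman's inequality \<open>|X + S| \<ge> |X| + |S| - 1\<close>. For \<open>k = 2\<close> it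
  makes \<open>M\<close> a Sidon set; if equality holds in Kemperman's inequality for some \<open>X\<close> with at least two
  elements, comparing \<open>M\<close> with a 2-atom for \<open>M\<close> on the other side forces \<open>|M| = 2\<close>, and then
  \<open>|M + S| = |S| + 1\<close> says that \<open>S\<close> is a progression.

  With \<open>A\<^sub>j = {x \<in> A. \<mu> x \<ge> j}\<close>, the set \<open>A\<^sub>l + \<dots> + A\<^sub>2 + A\<^sub>1\<close> is contained in \<open>\<Sigma>\<^sup>l\<close>, so the
  hypothesis on \<open>|\<Sigma>\<^sup>l|\<close> forces equality for the pair \<open>A\<^sub>l + \<dots> + A\<^sub>2\<close> and \<open>A\<^sub>1 = A\<close>.
\<close>

section \<open>Multiples in a torsion-free group\<close>

lemma nsmul_0 [simp]: "nsmul 0 x = 0"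
  by (simp add: nsmul_def)

lemma nsmul_Suc: "nsmul (Suc n) x = x + nsmul n x"
  by (simp add: nsmul_def)

lemma nsmul_add: "nsmul (m + n) x = nsmul m x + nsmul n x"
  by (simp add: nsmul_def replicate_add)

lemma nsmul_Suc_right: "nsmul (Suc n) x = nsmul n x + x"
  using nsmul_add[of n 1 x] by (simp add: nsmul_Suc)

lemma nsmul_conjugate:
  fixes c d :: "'a::group_add"
  shows "nsmul n (- c + d + c) = - c + nsmul n d + c"
  by (induction n) (simp_all add: nsmul_Suc add.assoc)

lemma nsmul_minus_add_nsmul:
  fixes d :: "'a::group_add"
  shows "nsmul n (- d) + nsmul n d = 0"
proof (induction n)
  case (Suc n)
  have "nsmul (Suc n) (- d) + nsmul (Suc n) d = nsmul n (- d) + (- d + d) + nsmul n d"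
    by (simp only: nsmul_Suc_right[of n "- d"] nsmul_Suc[of n d] add.assoc)
  with Suc show ?case by simp
qed simp

lemma torsion_free_inj_nsmul:
  fixes d :: "'a::group_add"
  assumes "torsion_free TYPE('a)" and "d \<noteq> 0"
  shows "inj (\<lambda>n. nsmul n d)"
proof (rule linorder_injI)
  fix m n :: nat
  assume "m < n"
  then obtain k where k: "n = m + k" "0 < k"
    using less_imp_add_positive by blast
  have "nsmul k d \<noteq> 0"
    using assms k(2) unfolding torsion_free_def by blast
  then show "nsmul m d \<noteq> nsmul n d"
    using add_left_imp_eq[of "nsmul m d" 0 "nsmul k d"] by (auto simp: k(1) nsmul_add)
qed

lemma torsion_free_inj_nsmul_add:
  fixes d :: "'a::group_add"
  assumes "torsion_free TYPE('a)" and "d \<noteq> 0"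
  shows "inj (\<lambda>n. nsmul n d + x)"
  using torsion_free_inj_nsmul[OF assms] by (simp add: inj_def)

text \<open>For \<open>x\<close> in \<open>M\<close> the points \<open>nsmul n g + x\<close> stay in
  \<open>M\<close>, and torsion-freeness makes them distinct.\<close>

lemma translation_invariant_infinite:
  fixes g :: "'a::group_add"
  assumes "torsion_free TYPE('a)" and "g \<noteq> 0" and "M \<noteq> {}" and "(+) g ` M = M"
  shows "infinite M"
proof -
  obtain x where "x \<in> M" using assms(3) by blast
  have "nsmul n g + x \<in> M" for n
    by (induction n) (use \<open>x \<in> M\<close> assms(4) in \<open>auto simp: nsmul_Suc add.assoc\<close>)
  then have "range (\<lambda>n. nsmul n g + x) \<subseteq> M" by blast
  moreover have "infinite (range (\<lambda>n. nsmul n g + x))"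
    using torsion_free_inj_nsmul_add[OF assms(1,2)] by (simp add: finite_image_iff)
  ultimately show ?thesis using infinite_super by blast
qed

section \<open>Sizes of sumsets\<close>

lemma finite_set_plus:
  "finite A \<Longrightarrow> finite B \<Longrightarrow> finite (A + B)"
  unfolding set_plus_image by simp

lemma set_plus_Un_left: "(X \<union> Y) + S = (X + S) \<union> (Y + S)"
  by (auto simp: set_plus_def)

lemma set_plus_Un_right: "S + (X \<union> Y) = (S + X) \<union> (S + Y)"
  by (auto simp: set_plus_def)

lemma card_singleton_set_plus:
  fixes x :: "'a::group_add"
  shows "card ({x} + S) = card S"
proof -
  have "{x} + S = (+) x ` S" by (auto simp: set_plus_def)
  then show ?thesis by (simp add: card_image)
qed

lemma card_set_plus_singleton:
  fixes x :: "'a::group_add"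
  shows "card (S + {x}) = card S"
proof -
  have "S + {x} = (\<lambda>y. y + x) ` S" by (auto simp: set_plus_def)
  then show ?thesis by (simp add: card_image inj_on_def)
qed

lemma card_set_plus_ge_left:
  fixes S :: "'a::group_add set"
  assumes "finite X" and "finite S" and "S \<noteq> {}"
  shows "card X \<le> card (X + S)"
proof -
  obtain s where "s \<in> S" using assms(3) by blast
  then have "X + {s} \<subseteq> X + S" by (auto simp: set_plus_def)
  then have "card (X + {s}) \<le> card (X + S)"
    using card_mono finite_set_plus[OF assms(1,2)] by blast
  then show ?thesis by (simp add: card_set_plus_singleton)
qed

lemma translate_set_plus:
  fixes g :: "'a::semigroup_add"
  shows "((+) g ` M) + S = (+) g ` (M + S)"
proof -
  have "((+) g ` M) + S = ({g} + M) + S" by (auto simp: set_plus_def)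
  also have "\<dots> = {g} + (M + S)" by (rule add.assoc)
  also have "\<dots> = (+) g ` (M + S)" by (auto simp: set_plus_def)
  finally show ?thesis .
qed

lemma uminus_set_plus:
  fixes X S :: "'a::group_add set"
  shows "uminus ` (X + S) = uminus ` S + uminus ` X"
proof -
  have "uminus ` (X + S) = (\<lambda>(x, s). - s + - x) ` (X \<times> S)"
    unfolding set_plus_image by (simp add: image_image case_prod_beta minus_add del: add_uminus_conv_diff)
  then show ?thesis
    by (force simp: set_plus_def)
qed

lemma card_uminus_set_plus:
  fixes X S :: "'a::group_add set"
  shows "card (uminus ` S + uminus ` X) = card (X + S)"
  by (simp add: uminus_set_plus[symmetric] card_image)

text \<open>The union of \<open>X + S\<close> and \<open>Y + S\<close> is exactly
  \<open>(X \<union> Y) + S\<close>, while their intersection may be larger than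
  \<open>(X \<inter> Y) + S\<close>.\<close>

lemma card_set_plus_submodular:
  fixes S :: "'a::group_add set"
  assumes "finite X" and "finite Y" and "finite S"
  shows "card ((X \<union> Y) + S) + card ((X \<inter> Y) + S) \<le> card (X + S) + card (Y + S)"
proof -
  have "(X \<inter> Y) + S \<subseteq> (X + S) \<inter> (Y + S)"
    by (auto simp: set_plus_def)
  then have "card ((X \<inter> Y) + S) \<le> card ((X + S) \<inter> (Y + S))"
    using assms by (intro card_mono) (auto simp: finite_set_plus)
  moreover have "card (X + S) + card (Y + S)
      = card ((X + S) \<union> (Y + S)) + card ((X + S) \<inter> (Y + S))"
    using assms by (intro card_Un_Int finite_set_plus)
  ultimately show ?thesis by (simp add: set_plus_Un_left)
qed

section \<open>Atoms and Kemperman's inequality\<close>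

text \<open>\<open>X0\<close> provides an admissible set. Among the minimisers of
  \<open>|X + S| - |X|\<close> take one of least size: if it met a translate in \<open>k\<close>
  points, submodularity would make the intersection a minimiser too, so the translate would equal
  \<open>M\<close>, which is impossible for a finite set.\<close>

lemma atom_exists:
  fixes S X0 :: "'a::group_add set"
  assumes "torsion_free TYPE('a)" and "finite S" and "S \<noteq> {}"
    and "1 \<le> k" and "finite X0" and "k \<le> card X0"
  obtains M where "finite M" and "k \<le> card M"
    and "\<And>X. finite X \<Longrightarrow> k \<le> card X \<Longrightarrow> card (M + S) + card X \<le> card (X + S) + card M"
    and "\<And>g. g \<noteq> 0 \<Longrightarrow> card (M \<inter> (+) g ` M) < k"
proof -
  define P where "P X \<longleftrightarrow> finite X \<and> k \<le> card X" for X :: "'a set"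
  define f where "f X = card (X + S) - card X" for X
  \<comment> \<open>Since \<open>card X \<le> card (X + S)\<close>, the subtraction in
    \<open>f\<close> is never truncated.\<close>
  have fX: "card (X + S) = card X + f X" if "finite X" for X
    using card_set_plus_ge_left[OF that assms(2,3)] by (simp add: f_def)
  have "P X0" using assms by (simp add: P_def)
  then obtain F where F: "P F" "\<And>X. P X \<Longrightarrow> f F \<le> f X"
    using exists_least_iff[of "\<lambda>n. \<exists>X. P X \<and> f X = n"] by (metis not_le)
  obtain M where M: "P M" "f M = f F" "\<And>X. P X \<Longrightarrow> f X = f F \<Longrightarrow> card M \<le> card X"
    using F(1) exists_least_iff[of "\<lambda>n. \<exists>X. P X \<and> f X = f F \<and> card X = n"]
    by (metis not_le)
  have finM: "finite M" and kM: "k \<le> card M" using M(1) by (auto simp: P_def)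
  show thesis
  proof
    show "finite M" "k \<le> card M" by fact+
    show "card (M + S) + card X \<le> card (X + S) + card M" if "finite X" "k \<le> card X" for X
      using F(2)[of X] that fX[OF finM] fX[OF that(1)] M(2) by (simp add: P_def)
    show "card (M \<inter> (+) g ` M) < k" if "g \<noteq> 0" for g
    proof (rule ccontr)
      let ?N = "(+) g ` M"
      assume "\<not> card (M \<inter> ?N) < k"
      then have P: "P (M \<inter> ?N)" "P (M \<union> ?N)"
        using finM kM by (auto simp: P_def intro: le_trans[OF _ card_mono])
      have cN: "card ?N = card M" "card (?N + S) = card (M + S)" "finite ?N"
        using finM by (simp_all add: card_image translate_set_plus)
      \<comment> \<open>With submodularity, the values of \<open>f\<close> at the union and the
        intersection sum to at most \<open>2 * f F\<close>; each is at least
        \<open>f F\<close>.\<close>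
      have "card M + card ?N = card (M \<union> ?N) + card (M \<inter> ?N)"
        using finM by (intro card_Un_Int) auto
      moreover have "f F \<le> f (M \<union> ?N)" "f F \<le> f (M \<inter> ?N)"
        using F(2) P by auto
      ultimately have "f (M \<inter> ?N) = f F"
        using card_set_plus_submodular[OF finM cN(3) assms(2)] cN fX[OF finM] fX[of "M \<union> ?N"]
          fX[of "M \<inter> ?N"] M(2) finM by simp
      then have le: "card M \<le> card (M \<inter> ?N)" using M(3) P(1) by blast
      then have "M \<inter> ?N = M" using card_seteq[OF finM, of "M \<inter> ?N"] by auto
      moreover have "M \<inter> ?N = ?N" using card_seteq[OF cN(3), of "M \<inter> ?N"] le cN(1) by auto
      ultimately have "?N = M" by simp
      moreover have "M \<noteq> {}" using kM assms(4) by auto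
      ultimately have "infinite M"
        using translation_invariant_infinite[OF assms(1) that] by blast
      with finM show False by blast
    qed
  qed
qed

text \<open>A 1-atom is disjoint from its translates by nonzero elements, but distinct
  \<open>x\<close> and \<open>y\<close> in it would put \<open>y\<close> in both \<open>M\<close>
  and \<open>(y - x) + M\<close>.\<close>

lemma kemperman:
  fixes X S :: "'a::group_add set"
  assumes "torsion_free TYPE('a)" and "finite X" and "X \<noteq> {}" and "finite S" and "S \<noteq> {}"
  shows "card X + card S \<le> card (X + S) + 1"
proof -
  have X: "1 \<le> card X" using assms(2,3) by (simp add: Suc_le_eq card_gt_0_iff)
  obtain M where M: "finite M" "1 \<le> card M"
    "card (M + S) + card X \<le> card (X + S) + card M"
    "\<And>g. g \<noteq> 0 \<Longrightarrow> card (M \<inter> (+) g ` M) < 1"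
    using atom_exists[OF assms(1,4,5) le_refl assms(2) X] assms(2) X by metis
  obtain x where x: "x \<in> M" using M(2) by fastforce
  have "y = x" if "y \<in> M" for y
  proof (rule ccontr)
    assume "y \<noteq> x"
    then have "card (M \<inter> (+) (y - x) ` M) < 1" using M(4) by simp
    moreover have "y \<in> M \<inter> (+) (y - x) ` M"
      using that x by (auto intro: image_eqI[of _ _ x])
    ultimately show False using M(1) by (auto simp: card_eq_0_iff)
  qed
  then have "M = {x}" using x by blast
  with M(3) show ?thesis by (simp add: card_singleton_set_plus)
qed

text \<open>Each addition loses at most one element against the sum of the sizes; the empty list
  gives \<open>{0}\<close>, with equality.\<close>

lemma kemperman_sum_list:
  fixes Bs :: "'a::group_add set list"
  assumes "torsion_free TYPE('a)" and "\<And>B. B \<in> set Bs \<Longrightarrow> finite B \<and> B \<noteq> {}"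
  shows "finite (sum_list Bs) \<and> sum_list Bs \<noteq> {}
    \<and> sum_list (map card Bs) + 1 \<le> card (sum_list Bs) + length Bs"
  using assms(2)
proof (induction Bs)
  case Nil
  then show ?case by simp
next
  case (Cons B Bs)
  have B: "finite B" "B \<noteq> {}" using Cons.prems[of B] by simp_all
  have Bs: "finite (sum_list Bs)" "sum_list Bs \<noteq> {}"
    "sum_list (map card Bs) + 1 \<le> card (sum_list Bs) + length Bs"
    using Cons.IH Cons.prems by (metis list.set_intros(2))+
  have "B + sum_list Bs \<noteq> {}" using B Bs by (auto simp: set_plus_def)
  then show ?case
    using kemperman[OF assms(1) B Bs(1,2)] Bs(3) B Bs(1) by (simp add: finite_set_plus)
qed

section \<open>Sidon sets\<close>

text \<open>The differences \<open>- x + y\<close> are those unchanged by left translation, so the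
  condition says that distinct left translates of \<open>M\<close> share at most one point.\<close>

definition sidon :: "'a::group_add set \<Rightarrow> bool" where
  "sidon M \<longleftrightarrow> (\<forall>x\<in>M. \<forall>y\<in>M. \<forall>z\<in>M. \<forall>w\<in>M. x \<noteq> y \<and> - x + y = - z + w \<longrightarrow> x = z)"

lemma sidonI:
  fixes M :: "'a::group_add set"
  assumes "finite M" and "\<And>g. g \<noteq> 0 \<Longrightarrow> card (M \<inter> (+) g ` M) < 2"
  shows "sidon M"
  unfolding sidon_def
proof (intro ballI impI, rule ccontr)
  fix x y z w
  assume *: "x \<in> M" "y \<in> M" "z \<in> M" "w \<in> M" "x \<noteq> y \<and> - x + y = - z + w" "x \<noteq> z"
  have "y = x + (- x + y)" by (simp add: add.assoc[symmetric])
  also have "\<dots> = x - z + w" using * by (simp add: add.assoc[symmetric])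
  finally have "y \<in> M \<inter> (+) (x - z) ` M" using * by auto
  moreover have "x \<in> M \<inter> (+) (x - z) ` M" using * by (auto intro: image_eqI[of _ _ z])
  ultimately have "{x, y} \<subseteq> M \<inter> (+) (x - z) ` M" by blast
  then have "card {x, y} \<le> card (M \<inter> (+) (x - z) ` M)" using assms(1) by (intro card_mono) auto
  then show False using * assms(2)[of "x - z"] by simp
qed

text \<open>A common point \<open>x + s = y + t\<close> gives \<open>- x + y = s - t\<close>, a
  nonzero difference that determines \<open>x\<close>. This passes from left translates to the right
  translates that make up \<open>M + S\<close>.\<close>

lemma sidon_card_Int_right_translates:
  fixes M :: "'a::group_add set"
  assumes "sidon M" and "finite M" and "s \<noteq> t"
  shows "card ((M + {s}) \<inter> (M + {t})) \<le> 1"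
proof -
  have "u = v" if uv: "u \<in> (M + {s}) \<inter> (M + {t})" "v \<in> (M + {s}) \<inter> (M + {t})" for u v
  proof -
    obtain x y z w where *: "x \<in> M" "y \<in> M" "z \<in> M" "w \<in> M"
      "u = x + s" "u = y + t" "v = z + s" "v = w + t"
      using uv by (auto simp: set_plus_def)
    have "- x + y = s - t"
    proof -
      have "y = x + s - t" using *(5,6) by (metis add_diff_cancel)
      then show ?thesis by (simp add: diff_conv_add_uminus add.assoc del: add_uminus_conv_diff)
    qed
    moreover have "- z + w = s - t"
    proof -
      have "w = z + s - t" using *(7,8) by (metis add_diff_cancel)
      then show ?thesis by (simp add: diff_conv_add_uminus add.assoc del: add_uminus_conv_diff)
    qed
    moreover have "x \<noteq> y" using * assms(3) by auto
    ultimately have "x = z" using assms(1) * unfolding sidon_def by metis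
    then show ?thesis using * by simp
  qed
  then show ?thesis
    using assms(2) by (simp add: card_le_Suc0_iff_eq finite_set_plus)
qed

text \<open>\<open>M + {s}\<close> meets each \<open>M + {t}\<close> in at most one point, hence
  contributes at least \<open>card M - card S\<close> new elements.\<close>

lemma sidon_card_set_plus_insert:
  fixes M :: "'a::group_add set"
  assumes "sidon M" and "finite M" and "finite S" and "s \<notin> S"
  shows "card (M + S) + card M \<le> card (M + insert s S) + card S"
proof -
  have "(M + {s}) \<inter> (M + S) = (\<Union>t\<in>S. (M + {s}) \<inter> (M + {t}))"
    by (auto simp: set_plus_def)
  then have "card ((M + {s}) \<inter> (M + S)) \<le> (\<Sum>t\<in>S. card ((M + {s}) \<inter> (M + {t})))"
    using card_UN_le[OF assms(3)] by metis
  also have "\<dots> \<le> (\<Sum>t\<in>S. 1)"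
    using sidon_card_Int_right_translates[OF assms(1,2)] assms(4) by (intro sum_mono) metis
  finally have "card ((M + {s}) \<inter> (M + S)) \<le> card S" by simp
  moreover have "card (M + {s}) + card (M + S)
      = card ((M + {s}) \<union> (M + S)) + card ((M + {s}) \<inter> (M + S))"
    using assms by (intro card_Un_Int finite_set_plus) auto
  moreover have "M + insert s S = (M + {s}) \<union> (M + S)"
    using set_plus_Un_right[of M "{s}" S] by simp
  ultimately show ?thesis by (simp add: card_set_plus_singleton)
qed

lemma sidon_card_set_plus:
  fixes M :: "'a::group_add set"
  assumes "sidon M" and "finite M" and "3 \<le> card M"
    and "finite S" and "2 \<le> card S" and "card S \<le> card M"
  shows "card M + card S \<le> card (M + S)"
proof -
  have "S \<noteq> {}" using assms(5) by auto
  \<comment> \<open>The second element of \<open>S\<close> already gains \<open>card M - 1 \<ge> 2\<close> elements, each later one at least one.\<close>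
  with assms(4) have "card S \<le> card M \<Longrightarrow>
      card M + card S \<le> card (M + S) + (if card S = 1 then 1 else 0)"
  proof (induction S rule: finite_ne_induct)
    case (singleton x)
    then show ?case by (simp add: card_set_plus_singleton)
  next
    case (insert s S)
    then show ?case
      using sidon_card_set_plus_insert[OF assms(1,2) insert(1,3)] assms(3)
      by (cases "card S = 1") (auto simp: card_eq_0_iff)
  qed
  with assms show ?thesis by simp
qed

section \<open>Equality in Kemperman's inequality\<close>

text \<open>Up to left translation the pair is \<open>{0, d}\<close>, so at most one element
  \<open>e\<close> of \<open>d + S\<close> lies outside \<open>S\<close>. Adding \<open>d\<close>
  repeatedly to an element of the finite set \<open>S\<close> must leave it, and can do so only at
  \<open>e\<close>; hence \<open>S\<close> is a chain without gaps descending from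
  \<open>e\<close>.\<close>

lemma arith_prog_of_card_pair_set_plus:
  fixes S :: "'a::group_add set"
  assumes tf: "torsion_free TYPE('a)" and "finite S" and "p \<noteq> q"
    and card: "card ({p, q} + S) \<le> card S + 1"
  shows "arith_prog S"
proof -
  define d where "d = - p + q"
  have "d \<noteq> 0" using assms(3) by (simp add: d_def neg_eq_iff_add_eq_0[symmetric])
  have "{p, q} + S = (+) p ` (S \<union> (+) d ` S)"
    by (auto simp: set_plus_def d_def image_Un image_image add.assoc[symmetric])
  then have "card (S \<union> (+) d ` S) \<le> card S + 1"
    using card by (simp add: card_image)
  then have "card ((+) d ` S - S) \<le> 1"
    using card_Diff_subset[OF assms(2), of "S \<union> (+) d ` S"] by (simp add: Un_Diff)
  then obtain e where e: "(+) d ` S - S \<subseteq> {e}"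
    using assms(2) card_le_Suc0_iff_eq[of "(+) d ` S - S"]
    by (metis One_nat_def finite_Diff finite_imageI insertCI subsetI)
  \<comment> \<open>Positions are counted down from \<open>- d + e\<close>, as \<open>e\<close>
    itself is the exit point.\<close>
  define I where "I = {n. nsmul n (- d) + (- d + e) \<in> S}"
  have "inj (\<lambda>n. nsmul n (- d) + (- d + e))"
    using torsion_free_inj_nsmul_add[OF tf, of "- d"] \<open>d \<noteq> 0\<close> by simp
  then have "finite I"
    using finite_vimageI[OF assms(2)] by (simp add: I_def vimage_def)
  have chain: "\<exists>n. x = nsmul n (- d) + (- d + e) \<and> {..n} \<subseteq> I" if "x \<in> S" for x
  proof -
    have "\<exists>n. nsmul n d + x \<notin> S"
    proof (rule ccontr)
      assume "\<nexists>n. nsmul n d + x \<notin> S"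
      then have "range (\<lambda>n. nsmul n d + x) \<subseteq> S" by blast
      then show False
        using finite_subset[OF _ assms(2)] finite_imageD[OF _ torsion_free_inj_nsmul_add[OF tf \<open>d \<noteq> 0\<close>]]
          infinite_UNIV_nat by blast
    qed
    then obtain n where n: "nsmul n d + x \<notin> S" "\<And>m. m < n \<Longrightarrow> nsmul m d + x \<in> S"
      using exists_least_iff[of "\<lambda>n. nsmul n d + x \<notin> S"] by blast
    obtain k where k: "n = Suc k" using n(1) \<open>x \<in> S\<close> by (cases n) auto
    have "nsmul n d + x \<in> (+) d ` S"
      using n(2)[of k] by (simp add: k nsmul_Suc add.assoc)
    then have ne: "nsmul n d + x = e" using e n(1) by blast
    have eq: "nsmul j (- d) + (- d + e) = nsmul (k - j) d + x" if "j \<le> k" for j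
    proof -
      have "n = Suc j + (k - j)" using that k by simp
      then have "e = nsmul (Suc j) d + (nsmul (k - j) d + x)"
        using ne by (simp only: nsmul_add add.assoc)
      then have "nsmul (Suc j) (- d) + e = nsmul (k - j) d + x"
        by (simp only: add.assoc[symmetric] nsmul_minus_add_nsmul add_0_left)
      then show ?thesis by (simp add: nsmul_Suc_right add.assoc del: add_uminus_conv_diff)
    qed
    have "x = nsmul k (- d) + (- d + e)" using eq[of k] by simp
    moreover have "{..k} \<subseteq> I"
      using eq n(2) k by (auto simp: I_def)
    ultimately show ?thesis by blast
  qed
  have down: "j \<in> I" if "n \<in> I" "j \<le> n" for j n
  proof -
    have "nsmul n (- d) + (- d + e) \<in> S" using that(1) unfolding I_def by (rule CollectD)
    then obtain n' where n': "nsmul n (- d) + (- d + e) = nsmul n' (- d) + (- d + e)" "{..n'} \<subseteq> I"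
      using chain by blast
    have "n = n'"
      using injD[OF \<open>inj (\<lambda>n. nsmul n (- d) + (- d + e))\<close> n'(1)] .
    then show ?thesis using n'(2) that(2) by blast
  qed
  have "\<exists>k. I = {..<k}"
  proof (cases "I = {}")
    case True
    then show ?thesis by (intro exI[of _ 0]) simp
  next
    case False
    have "j \<in> I \<longleftrightarrow> j < Suc (Max I)" for j
      using down[OF Max_in[OF \<open>finite I\<close> False], of j] Max_ge[OF \<open>finite I\<close>, of j]
      unfolding less_Suc_eq_le by blast
    then have "I = {..<Suc (Max I)}" by blast
    then show ?thesis ..
  qed
  then obtain k where k: "I = {..<k}" ..
  have S: "S = {nsmul j (- d) + (- d + e) | j. j < k}"
  proof (intro equalityI subsetI)
    fix x
    assume "x \<in> S"
    then obtain n where "x = nsmul n (- d) + (- d + e)" "{..n} \<subseteq> I"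
      using chain by blast
    moreover from this have "n < k" using k by auto
    ultimately show "x \<in> {nsmul j (- d) + (- d + e) | j. j < k}" by blast
  next
    fix x
    assume "x \<in> {nsmul j (- d) + (- d + e) | j. j < k}"
    then obtain j where "x = nsmul j (- d) + (- d + e)" "j \<in> I" using k by blast
    then show "x \<in> S" unfolding I_def by simp
  qed
  \<comment> \<open>The multiples stand to the left of the base point, in \<open>arith_prog\<close>
    to its right; conjugating by \<open>c\<close> exchanges the sides and keeps the difference
    nonzero.\<close>
  define c where "c = - d + e"
  have "nsmul j (- d) + c = c + nsmul j (- c + - d + c)" for j
    by (simp only: nsmul_conjugate add.assoc[symmetric] right_minus add_0_left)
  then have "S = {c + nsmul j (- c + - d + c) | j. j < k}"
    using S by (simp only: c_def[symmetric])
  moreover have "- c + - d + c \<noteq> 0"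
  proof
    assume "- c + - d + c = 0"
    then have "c + (- c + - d + c) + - c = 0"
      by (simp only: add_0_right right_minus)
    then have "- d = 0"
      by (simp only: add.assoc right_minus add_0_right) (simp only: add.assoc[symmetric] right_minus add_0_left)
    with \<open>d \<noteq> 0\<close> show False by simp
  qed
  ultimately show ?thesis unfolding arith_prog_def by (intro exI conjI)
qed

theorem brailovsky_freiman:
  fixes X S :: "'a::group_add set"
  assumes tf: "torsion_free TYPE('a)" and "finite X" and "2 \<le> card X"
    and "finite S" and "2 \<le> card S" and "card (X + S) + 1 \<le> card X + card S"
  shows "arith_prog S"
proof -
  have ne: "S \<noteq> {}" using assms(5) by auto
  obtain M where M: "finite M" "2 \<le> card M"
    "card (M + S) + card X \<le> card (X + S) + card M"
    and "\<And>g. g \<noteq> 0 \<Longrightarrow> card (M \<inter> (+) g ` M) < 2"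
    using atom_exists[OF tf assms(4) ne one_le_numeral assms(2,3)] assms(2,3) by metis
  then have "sidon M" by (intro sidonI) auto
  have MS: "card (M + S) + 1 \<le> card M + card S" using M(3) assms(6) by linarith
  \<comment> \<open>Atoms are left summands; negation reverses the sum, so \<open>- S\<close>
    becomes a left summand for \<open>- M\<close>.\<close>
  let ?M = "uminus ` M" and ?S = "uminus ` S"
  have cM: "card ?M = card M" and cS: "card ?S = card S" by (simp_all add: card_image)
  have fin: "finite ?M" "?M \<noteq> {}" "finite ?S" "2 \<le> card ?S"
    using M assms cS by auto
  obtain N where N: "finite N" "2 \<le> card N"
    "card (N + ?M) + card ?S \<le> card (?S + ?M) + card N"
    and "\<And>g. g \<noteq> 0 \<Longrightarrow> card (N \<inter> (+) g ` N) < 2"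
    using atom_exists[OF tf fin(1,2) one_le_numeral fin(3,4)] fin(3,4) by metis
  then have "sidon N" by (intro sidonI) auto
  have NM: "card (N + ?M) + 1 \<le> card N + card M"
    using N(3) MS card_uminus_set_plus[of S M] cS by linarith
  have MN: "card (M + uminus ` N) = card (N + ?M)"
    using card_uminus_set_plus[of ?M N] by (simp add: image_image)
  have cN: "card (uminus ` N) = card N" by (simp add: card_image)
  have "card M = 2"
  proof (rule ccontr)
    assume "card M \<noteq> 2"
    then have "3 \<le> card M" using M(2) by linarith
    \<comment> \<open>The bound for Sidon sets is applied to the larger of \<open>M\<close> and
      \<open>N\<close>: to \<open>M\<close> with \<open>- N\<close>, or to \<open>N\<close> with
      \<open>- M\<close>. Either way it contradicts \<open>NM\<close>.\<close>
    show False
    proof (cases "card N \<le> card M")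
      case True
      then show False
        using sidon_card_set_plus[OF \<open>sidon M\<close> M(1) \<open>3 \<le> card M\<close>, of "uminus ` N"] N NM MN cN
        by simp
    next
      case False
      then show False
        using sidon_card_set_plus[OF \<open>sidon N\<close> N(1), of ?M] \<open>3 \<le> card M\<close> fin cM NM by simp
    qed
  qed
  then obtain p q where "M = {p, q}" "p \<noteq> q" by (auto simp: card_2_iff)
  then show ?thesis
    using arith_prog_of_card_pair_set_plus[OF tf assms(4)] MS \<open>card M = 2\<close> by simp
qed

section \<open>Restricted sums and level sets\<close>

text \<open>Greedy choice: removing the index used for the head lowers only the multiplicity of that
  value, by one.\<close>

lemma exists_distinct_indices:
  assumes "finite I" and "\<And>x. count_list xs x \<le> card {i \<in> I. a i = x}"
  shows "\<exists>is. distinct is \<and> set is \<subseteq> I \<and> map a is = xs"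
  using assms
proof (induction xs arbitrary: I)
  case (Cons x xs)
  have "0 < card {i \<in> I. a i = x}" using Cons.prems(2)[of x] by simp
  then obtain i where i: "i \<in> I" "a i = x" by (auto simp: card_gt_0_iff)
  have "count_list xs y \<le> card {j \<in> I - {i}. a j = y}" for y
  proof (cases "y = x")
    case True
    then have "{j \<in> I - {i}. a j = y} = {j \<in> I. a j = y} - {i}" by auto
    then show ?thesis using Cons.prems(2)[of y] i True by simp
  next
    case False
    then have "{j \<in> I - {i}. a j = y} = {j \<in> I. a j = y}" using i by auto
    then show ?thesis using Cons.prems(2)[of y] False by (simp split: if_splits)
  qed
  then obtain js where "distinct js" "set js \<subseteq> I - {i}" "map a js = xs"
    using Cons.IH[of "I - {i}"] Cons.prems(1) by auto
  then show ?case using i by (intro exI[of _ "i # js"]) auto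
qed simp

lemma sum_list_in_restricted_sumset:
  assumes "length xs = l" and "\<And>x. count_list xs x \<le> rho m a x"
  shows "sum_list xs \<in> restricted_sumset l m a"
proof -
  obtain js where "distinct js" "set js \<subseteq> {1..m}" "map a js = xs"
    using exists_distinct_indices[of "{1..m}" xs a] assms(2) by (auto simp: rho_def)
  then show ?thesis
    unfolding restricted_sumset_def using assms(1) by (metis (mono_tags, lifting) length_map mem_Collect_eq)
qed

lemma finite_restricted_sumset: "finite (restricted_sumset l m a)"
proof -
  have "finite {is. set is \<subseteq> {1..m} \<and> length is = l}"
    by (rule finite_lists_length_eq) simp
  then have "finite ((\<lambda>is. sum_list (map a is)) ` {is. set is \<subseteq> {1..m} \<and> length is = l})"
    by simp
  then show ?thesis
    by (rule rev_finite_subset) (auto simp: restricted_sumset_def)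
qed

text \<open>The reversed list puts the highest level first. A term \<open>y\<close> from level
  \<open>n\<close> has \<open>n < rho m a y\<close>, so it may be added even if all \<open>n\<close>
  other terms equal \<open>y\<close>.\<close>

lemma mem_sum_list_levels:
  fixes a :: "nat \<Rightarrow> 'a::monoid_add"
  assumes "t \<in> sum_list (map (\<lambda>j. {x \<in> A. j < mu l m a x}) (rev [0..<n]))"
  shows "\<exists>xs. length xs = n \<and> sum_list xs = t \<and> (\<forall>x. count_list xs x \<le> rho m a x)"
  using assms
proof (induction n arbitrary: t)
  case 0
  then show ?case by simp
next
  case (Suc n)
  then obtain y u where t: "t = y + u" and y: "n < mu l m a y"
    and u: "u \<in> sum_list (map (\<lambda>j. {x \<in> A. j < mu l m a x}) (rev [0..<n]))"
    by (auto simp: set_plus_def)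
  obtain xs where xs: "length xs = n" "sum_list xs = u" "\<forall>x. count_list xs x \<le> rho m a x"
    using Suc.IH[OF u] by blast
  have "count_list xs y \<le> n" using count_le_length[of xs y] xs(1) by simp
  then have "count_list (y # xs) x \<le> rho m a x" for x
    using xs(3) y by (auto simp: mu_def)
  then show ?case using xs t by (intro exI[of _ "y # xs"]) auto
qed

text \<open>Double counting of the pairs \<open>(j, x)\<close> with \<open>j < f x\<close>.\<close>

lemma sum_card_levels:
  fixes f :: "'a \<Rightarrow> nat"
  assumes "finite A" and "\<And>x. x \<in> A \<Longrightarrow> f x \<le> l"
  shows "(\<Sum>j<l. card {x \<in> A. j < f x}) = (\<Sum>x\<in>A. f x)"
proof -
  have "(\<Sum>j<l. card {x \<in> A. j < f x}) = (\<Sum>j<l. \<Sum>x\<in>A. of_bool (j < f x))"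
    using assms(1) by (simp add: Int_def)
  also have "\<dots> = (\<Sum>x\<in>A. \<Sum>j<l. of_bool (j < f x))" by (rule sum.swap)
  also have "\<dots> = (\<Sum>x\<in>A. f x)"
  proof (rule sum.cong)
    fix x assume "x \<in> A"
    then have "{..<l} \<inter> {j. j < f x} = {..<f x}" using assms(2) by fastforce
    then show "(\<Sum>j<l. of_bool (j < f x)) = f x" by simp
  qed simp
  finally show ?thesis .
qed

section \<open>From restricted sums to the equality case\<close>

theorem theorem6p6:
  fixes l m :: nat and a :: "nat \<Rightarrow> 'g::group_add" and A :: "'g set"
  assumes "2 \<le> l" and "l \<le> m"
    and "torsion_free TYPE('g)"
    and A_def: "A = a ` {1..m}"
    and "\<exists>x\<in>A. mu l m a x = l"
    and "card {x \<in> A. mu l m a x \<ge> 2} \<ge> 2"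
    and "int (card (restricted_sumset l m a)) = (\<Sum>x\<in>A. int (mu l m a x)) - int l + 1"
  shows "arith_prog A"
proof -
  \<comment> \<open>Counting from zero, \<open>L 0\<close> is \<open>A\<^sub>1\<close> and
    \<open>L (l - 1)\<close> is \<open>A\<^sub>l\<close>.\<close>
  define L where "L j = {x \<in> A. j < mu l m a x}" for j
  define T where "T = sum_list (map L (rev [1..<l]))"
  have finA: "finite A" by (simp add: A_def)
  \<comment> \<open>An element with \<open>mu\<close> equal to \<open>l\<close> lies in every level
    below \<open>l\<close>.\<close>
  have L: "finite (L j)" "j < l \<Longrightarrow> L j \<noteq> {}" for j
    using finA assms(5) by (auto simp: L_def)
  have L0: "L 0 = A"
  proof -
    have "0 < rho m a x" if "x \<in> A" for x
      using that by (auto simp: rho_def A_def card_gt_0_iff)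
    then show ?thesis using assms(1) by (auto simp: L_def mu_def)
  qed
  have L1: "2 \<le> card (L 1)"
    using assms(6) by (simp add: L_def Suc_le_eq numeral_2_eq_2)
  have A2: "2 \<le> card A"
    using L1 card_mono[OF finA, of "L 1"] by (auto simp: L_def)
  have fin_ne: "finite B \<and> B \<noteq> {}" if "B \<in> set (map L (rev [k..<l]))" for B k
    using that L by auto
  have upt: "[0..<l] = 0 # [1..<l]" "[1..<l] = 1 # [2..<l]"
    using assms(1) by (simp_all add: upt_conv_Cons numeral_2_eq_2)
  have T: "finite T" "T \<noteq> {}"
    "sum_list (map card (map L (rev [1..<l]))) + 1 \<le> card T + (l - 1)"
    using kemperman_sum_list[OF assms(3), of "map L (rev [1..<l])"] fin_ne by (simp_all add: T_def)
  \<comment> \<open>The equality case needs two elements in the left summand; \<open>L 1\<close> has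
    them and occurs in \<open>T\<close> because \<open>l \<ge> 2\<close>.\<close>
  have "2 \<le> card T"
  proof -
    let ?R = "sum_list (map L (rev [2..<l]))"
    have R: "finite ?R" "?R \<noteq> {}"
      using kemperman_sum_list[OF assms(3), of "map L (rev [2..<l])"] fin_ne by (simp_all add: o_def)
    have "T = ?R + L 1" by (simp add: T_def upt(2) del: One_nat_def set_zero)
    moreover have "1 \<le> card ?R" using R by (simp add: Suc_le_eq card_gt_0_iff)
    ultimately have "card (L 1) \<le> card T"
      using kemperman[OF assms(3) R, of "L 1"] L(1)[of 1] L(2)[of 1] assms(1) by simp
    then show ?thesis using L1 by simp
  qed
  have "T + A = sum_list (map L (rev [0..<l]))"
    by (simp add: T_def upt(1) L0 del: set_zero)
  then have "T + A \<subseteq> restricted_sumset l m a"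
    using mem_sum_list_levels sum_list_in_restricted_sumset unfolding L_def by fastforce
  then have "card (T + A) \<le> card (restricted_sumset l m a)"
    using card_mono[OF finite_restricted_sumset] by blast
  moreover have "card (restricted_sumset l m a) + l = (\<Sum>x\<in>A. mu l m a x) + 1"
    using assms(7) by (simp flip: of_nat_sum)
  moreover have "(\<Sum>x\<in>A. mu l m a x) = (\<Sum>j<l. card (L j))"
    unfolding L_def by (rule sum_card_levels[symmetric]) (simp_all add: finA mu_def)
  moreover have "(\<Sum>j<l. card (L j)) = card A + sum_list (map card (map L (rev [1..<l])))"
  proof -
    have "(\<Sum>j<l. card (L j)) = sum_list (map (\<lambda>j. card (L j)) [0..<l])"
      by (simp add: sum_list_distinct_conv_sum_set atLeast0LessThan)
    also have "\<dots> = card A + sum_list (map (\<lambda>j. card (L j)) [1..<l])"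
      by (simp add: upt(1) L0)
    finally show ?thesis by (simp add: o_def rev_map[symmetric])
  qed
  \<comment> \<open>Against the total of the level sizes, \<open>T + A\<close> loses at least
    \<open>l - 1\<close> elements and \<open>T\<close> at most \<open>l - 2\<close>, so adding
    \<open>A\<close> loses at least one.\<close>
  ultimately have "card (T + A) + 1 \<le> card T + card A"
    using T(3) assms(1) by linarith
  then show ?thesis
    using brailovsky_freiman[OF assms(3) T(1) \<open>2 \<le> card T\<close> finA A2] by blast
qed

end
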